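(* Let $n, k, d$ be positive integers satisfying $k > d \ge 2$ and $n \ge 2k+2d-3$. Then every intersecting family $\mathcal{F}$ of $k$-subsets of $[n]$ satisfies $$\delta_d(\mathcal{F})\le \binom{n-d-1}{k-d-1}.$$
   Context: $[n]=\{1,2,\dots,n\}$ and $\binom{[n]}{k}$ is the family of all $k$-element subsets of $[n]$. A family $\mathcal{F}\subset\binom{[n]}{k}$ is intersecting if $A\cap B\neq\emptyset$ for all $A,B\in\mathcal{F}$. For $S\subset[n]$, the $S$-degree of $\mathcal{F}$ is $d_S(\mathcal{F})=|\{T: S\subset T\in\mathcal{F}\}|$. For $0\le d\le k$, the minimum $d$-degree $\delta_d(\mathcal{F})$ is the minimum of $d_S(\mathcal{F})$ over all $S\subset[n]$ with $|S|=d$. *)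

theory Defs
  imports Complex_Main "HOL-Library.Ramsey"
begin

(* The k-subsets of a set A are nsets A k, from HOL-Library.Ramsey. *)

definition intersecting :: "'a set set \<Rightarrow> bool" where
  "intersecting F \<longleftrightarrow> (\<forall>A\<in>F. \<forall>B\<in>F. A \<inter> B \<noteq> {})"

definition set_degree :: "'a set \<Rightarrow> 'a set set \<Rightarrow> nat" where
  "set_degree S F = card {T \<in> F. S \<subseteq> T}"

(* The ground set V is explicit, as it cannot be recovered from the family F. The minimum
   is over a nonempty finite set, hence meaningful, when V is finite and d \<le> card V. *)
definition min_degree :: "'a set \<Rightarrow> nat \<Rightarrow> 'a set set \<Rightarrow> nat" where
  "min_degree V d F = Min ((\<lambda>S. set_degree S F) ` nsets V d)"

end

theory Submission
  imports Defs
begin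

text \<open>Suppose that every \<open>d\<close>-degree exceeds \<open>\<delta> = c * binom(n-d, k-d)\<close>, \<open>c = (k-d)/(n-d)\<close>, the \<open>d\<close>-degree in a
  star of a set avoiding the centre. Decompose the indicator function \<open>f\<close> of the family into its
  components \<open>f\<^sub>0, ..., f\<^sub>k\<close> in the Johnson scheme, and let \<open>X\<^sub>i\<close> be their squared norms and \<open>p\<close> the density of
  the family. Two quadratic relations are combined. Since the family is intersecting, the disjointness
  form vanishes at \<open>f\<close>, a relation between the \<open>X\<^sub>i\<close> which also yields \<open>p \<le> k/n\<close>. Since the vector \<open>g\<close> of
  excess degrees is positive, so is the sum of \<open>g S * g S'\<close> over disjoint \<open>d\<close>-sets; this form is chosen
  because it vanishes on stars. A suitable multiple of the first relation makes level 1 dominate all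
  higher levels in the second (here \<open>n \<ge> 2k+2d-3\<close> enters), and what remains is
  \<open>(p - c) (p n/k - 1) > 0\<close>. As averaging gives \<open>p > c\<close>, this contradicts \<open>p \<le> k/n\<close>.\<close>

subsection \<open>Harmonic functions and the level decomposition\<close>

text \<open>Defined on sets of every size, so that one \<open>h\<close> serves on
  \<open>k\<close>-sets, on \<open>d\<close>-sets and on complements.\<close>

definition lift :: "('a set \<Rightarrow> real) \<Rightarrow> nat \<Rightarrow> 'a set \<Rightarrow> real" where
  "lift h i T = (\<Sum>R\<in>nsets T i. h R)"

text \<open>For the indicator function of a family of \<open>k\<close>-sets this is the degree of
  \<open>S\<close>.\<close>

definition upper_sum :: "'a set \<Rightarrow> nat \<Rightarrow> ('a set \<Rightarrow> real) \<Rightarrow> 'a set \<Rightarrow> real" where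
  "upper_sum V k f S = (\<Sum>T\<in>{T\<in>nsets V k. S \<subseteq> T}. f T)"

text \<open>The kernel of the map from \<open>i\<close>-sets down to \<open>(i-1)\<close>-sets. For
  \<open>i <= k\<close> and \<open>2 * k <= card V\<close> its lifts to the \<open>k\<close>-sets
  form the \<open>i\<close>-th eigenspace of the Johnson scheme. At \<open>i = 0\<close> the
  condition is void, so constants are level 0.\<close>

definition harmonic :: "'a set \<Rightarrow> nat \<Rightarrow> ('a set \<Rightarrow> real) \<Rightarrow> bool" where
  "harmonic V i h \<longleftrightarrow> (\<forall>S\<subseteq>V. Suc (card S) = i \<longrightarrow> (\<Sum>x\<in>V-S. h (insert x S)) = 0)"

declare finite_imp_finite_nsets [simp]

section \<open>Counting subsets\<close>

lemma card_nsets: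
  assumes "finite V"
  shows "card (nsets V k) = card V choose k"
proof -
  have "nsets V k = {B. B \<subseteq> V \<and> card B = k}"
    using assms by (auto simp: nsets_def intro: finite_subset)
  with assms show ?thesis
    by (simp add: n_subsets)
qed

lemma card_nsets_supset:
  assumes "finite V" "R \<subseteq> V" "card R \<le> k"
  shows "card {T \<in> nsets V k. R \<subseteq> T} = (card V - card R) choose (k - card R)"
proof -
  have fR: "finite R"
    using assms finite_subset by blast
  have "bij_betw (\<lambda>T. T - R) {T \<in> nsets V k. R \<subseteq> T} (nsets (V - R) (k - card R))"
  proof (rule bij_betw_byWitness[where f' = "\<lambda>T. T \<union> R"])
    show "(\<lambda>T. T \<union> R) ` nsets (V - R) (k - card R) \<subseteq> {T \<in> nsets V k. R \<subseteq> T}"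
    proof clarify
      fix T assume "T \<in> nsets (V - R) (k - card R)"
      then have "T \<subseteq> V - R" "finite T" "card T = k - card R" "T \<inter> R = {}"
        by (auto simp: nsets_def)
      then show "T \<union> R \<in> nsets V k \<and> R \<subseteq> T \<union> R"
        using assms fR by (auto simp: nsets_def card_Un_disjoint)
    qed
  qed (use assms fR in \<open>auto simp: nsets_def card_Diff_subset\<close>)
  then have "card {T \<in> nsets V k. R \<subseteq> T} = card (nsets (V - R) (k - card R))"
    by (rule bij_betw_same_card)
  also have "\<dots> = (card V - card R) choose (k - card R)"
    using assms fR by (simp add: card_nsets card_Diff_subset)
  finally show ?thesis .
qed

text \<open>Both sides run over \<open>(j+1)\<close>-subsets with a marked element; removing the
  mark gives the indexing on the left.\<close>

lemma sum_nsets_marked: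
  fixes G :: "'a set \<Rightarrow> 'a \<Rightarrow> real"
  assumes "finite S"
  shows "(\<Sum>R\<in>nsets S j. \<Sum>x\<in>S-R. G (insert x R) x) = (\<Sum>T\<in>nsets S (Suc j). \<Sum>x\<in>T. G T x)"
proof -
  have "(\<Sum>R\<in>nsets S j. \<Sum>x\<in>S-R. G (insert x R) x)
      = (\<Sum>(R,x)\<in>(SIGMA R:nsets S j. S - R). G (insert x R) x)"
    using assms by (subst sum.Sigma) auto
  also have "\<dots> = (\<Sum>(T,x)\<in>(SIGMA T:nsets S (Suc j). T). G T x)"
    by (rule sum.reindex_bij_witness[where i = "\<lambda>(T,x). (T - {x}, x)" and j = "\<lambda>(R,x). (insert x R, x)"])
       (auto simp: nsets_def insert_absorb)
  also have "\<dots> = (\<Sum>T\<in>nsets S (Suc j). \<Sum>x\<in>T. G T x)"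
    using assms by (subst sum.Sigma) (auto simp: nsets_def)
  finally show ?thesis .
qed

lemma nsets_insert:
  assumes "x \<notin> S"
  shows "nsets (insert x S) (Suc j) = nsets S (Suc j) \<union> insert x ` nsets S j"
proof (intro equalityI subsetI)
  fix T assume T: "T \<in> nsets (insert x S) (Suc j)"
  show "T \<in> nsets S (Suc j) \<union> insert x ` nsets S j"
  proof (cases "x \<in> T")
    case True
    then have "T = insert x (T - {x})" "T - {x} \<in> nsets S j"
      using T by (auto simp: nsets_def)
    then show ?thesis by blast
  next
    case False
    with T show ?thesis by (auto simp: nsets_def)
  qed
qed (use assms in \<open>auto simp: nsets_def card_insert_if\<close>)

section \<open>Lifts and upper sums when a point is added\<close>

lemma lift_insert:
  assumes "finite S" "x \<notin> S"
  shows "lift h (Suc j) (insert x S) = lift h (Suc j) S + (\<Sum>R\<in>nsets S j. h (insert x R))"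
proof -
  have "inj_on (insert x) (nsets S j)"
    using assms by (force simp: inj_on_def nsets_def)
  moreover have "nsets S (Suc j) \<inter> insert x ` nsets S j = {}"
    using assms by (auto simp: nsets_def)
  ultimately show ?thesis
    using assms by (simp add: lift_def nsets_insert sum.union_disjoint sum.reindex)
qed

text \<open>An \<open>i\<close>-subset of \<open>insert x S\<close> either lies in \<open>S\<close>
  or contains \<open>x\<close>. For the second kind harmonicity replaces the sum over
  \<open>x\<close> outside \<open>S\<close> by minus the sum over \<open>x\<close> in
  \<open>S - R\<close>, which counts every \<open>i\<close>-subset of \<open>S\<close> exactly
  \<open>i\<close> times.\<close>

lemma sum_lift_insert:
  assumes V: "finite V" and h: "harmonic V i h" and S: "S \<subseteq> V"
  shows "(\<Sum>x\<in>V-S. lift h i (insert x S)) = (real (card V) - real (card S) - real i) * lift h i S"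
proof (cases i)
  case 0
  have "card (V - S) = card V - card S" "card S \<le> card V"
    using S V by (auto simp: card_Diff_subset finite_subset card_mono)
  then show ?thesis
    by (simp add: 0 lift_def)
next
  case (Suc j)
  have fS: "finite S" using S V finite_subset by blast
  have c: "card (V - S) = card V - card S" "card S \<le> card V"
    using S V by (auto simp: card_Diff_subset finite_subset card_mono)
  have "(\<Sum>x\<in>V-S. lift h i (insert x S))
      = (\<Sum>x\<in>V-S. lift h i S + (\<Sum>R\<in>nsets S j. h (insert x R)))"
    using fS by (intro sum.cong) (auto simp: Suc lift_insert)
  also have "\<dots> = (real (card V) - real (card S)) * lift h i S + (\<Sum>x\<in>V-S. \<Sum>R\<in>nsets S j. h (insert x R))"
    by (simp add: sum.distrib c of_nat_diff)
  also have "(\<Sum>x\<in>V-S. \<Sum>R\<in>nsets S j. h (insert x R)) = (\<Sum>R\<in>nsets S j. \<Sum>x\<in>V-S. h (insert x R))"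
    by (rule sum.swap)
  also have "\<dots> = (\<Sum>R\<in>nsets S j. - (\<Sum>x\<in>S-R. h (insert x R)))"
  proof (rule sum.cong[OF refl])
    fix R assume "R \<in> nsets S j"
    then have R: "R \<subseteq> S" "card R = j" by (auto simp: nsets_def)
    then have "V - R = (V - S) \<union> (S - R)" "(V - S) \<inter> (S - R) = {}"
      using S by auto
    then have "(\<Sum>x\<in>V-R. h (insert x R)) = (\<Sum>x\<in>V-S. h (insert x R)) + (\<Sum>x\<in>S-R. h (insert x R))"
      using V fS by (simp add: sum.union_disjoint)
    moreover have "(\<Sum>x\<in>V-R. h (insert x R)) = 0"
      using h R S Suc by (auto simp: harmonic_def)
    ultimately show "(\<Sum>x\<in>V-S. h (insert x R)) = - (\<Sum>x\<in>S-R. h (insert x R))"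
      by simp
  qed
  also have "\<dots> = - (\<Sum>T\<in>nsets S (Suc j). \<Sum>x\<in>T. h T)"
    using sum_nsets_marked[OF fS, where j = j and G = "\<lambda>T x. h T"] by (simp add: sum_negf)
  also have "(\<Sum>T\<in>nsets S (Suc j). \<Sum>x\<in>T. h T) = real i * lift h i S"
    by (simp add: lift_def Suc sum_distrib_left nsets_def)
  finally show ?thesis
    by (simp add: algebra_simps)
qed

lemma upper_sum_self:
  assumes "finite V" "S \<in> nsets V k"
  shows "upper_sum V k f S = f S"
proof -
  have "T = S" if "T \<in> nsets V k" "S \<subseteq> T" for T
    using that assms card_subset_eq[of T S] by (auto simp: nsets_def)
  then have "{T \<in> nsets V k. S \<subseteq> T} = {S}"
    using assms by blast
  then show ?thesis by (simp add: upper_sum_def)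
qed

text \<open>A \<open>k\<close>-set above \<open>S\<close> is counted once for each of its
  \<open>k - card S\<close> points outside \<open>S\<close>.\<close>

lemma upper_sum_insert:
  assumes V: "finite V" and S: "S \<subseteq> V"
  shows "(\<Sum>x\<in>V-S. upper_sum V k f (insert x S)) = (real k - real (card S)) * upper_sum V k f S"
proof -
  have fS: "finite S" using S V finite_subset by blast
  have "(\<Sum>x\<in>V-S. upper_sum V k f (insert x S))
      = (\<Sum>x\<in>V-S. \<Sum>T\<in>{T\<in>nsets V k. S \<subseteq> T}. if x \<in> T then f T else 0)"
    unfolding upper_sum_def
  proof (rule sum.cong[OF refl])
    fix x
    have "{T \<in> nsets V k. insert x S \<subseteq> T} = {T \<in> {T\<in>nsets V k. S \<subseteq> T}. x \<in> T}" by auto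
    moreover have "finite {T \<in> nsets V k. S \<subseteq> T}" using V by simp
    ultimately show "sum f {T \<in> nsets V k. insert x S \<subseteq> T} = (\<Sum>T\<in>{T\<in>nsets V k. S \<subseteq> T}. if x \<in> T then f T else 0)"
      by (simp only: sum.inter_filter)
  qed
  also have "\<dots> = (\<Sum>T\<in>{T\<in>nsets V k. S \<subseteq> T}. \<Sum>x\<in>V-S. if x \<in> T then f T else 0)"
    by (rule sum.swap)
  also have "\<dots> = (\<Sum>T\<in>{T\<in>nsets V k. S \<subseteq> T}. (real k - real (card S)) * f T)"
  proof (intro sum.cong refl)
    fix T assume T: "T \<in> {T\<in>nsets V k. S \<subseteq> T}"
    then have "(V - S) \<inter> T = T - S" "card (T - S) = k - card S" "card S \<le> k"
      using fS by (auto simp: nsets_def card_Diff_subset card_mono)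
    moreover have "(\<Sum>x\<in>V-S. if x \<in> T then f T else 0) = (\<Sum>x\<in>(V-S) \<inter> T. f T)"
      using V by (subst sum.inter_restrict) auto
    ultimately show "(\<Sum>x\<in>V-S. if x \<in> T then f T else 0) = (real k - real (card S)) * f T"
      by (simp add: of_nat_diff)
  qed
  also have "\<dots> = (real k - real (card S)) * upper_sum V k f S"
    by (simp add: upper_sum_def sum_distrib_left)
  finally show ?thesis .
qed

text \<open>Downward induction from \<open>card S = k\<close>: both insertion lemmas turn the sum
  over added points into a scalar multiple, and absorption matches the binomials. For
  \<open>card S < i\<close> the result says that the upper sum vanishes.\<close>

lemma upper_sum_lift:
  assumes V: "finite V" and h: "harmonic V i h" and ik: "i + k \<le> card V"
    and S: "S \<subseteq> V" "card S \<le> k"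
  shows "upper_sum V k (lift h i) S = real ((card V - card S - i) choose (k - card S)) * lift h i S"
  using S
proof (induction "k - card S" arbitrary: S)
  case 0
  then have "S \<in> nsets V k"
    using V finite_subset by (auto simp: nsets_def)
  with 0 V show ?case
    by (simp add: upper_sum_self)
next
  case (Suc m)
  have fS: "finite S" using Suc.prems(1) V finite_subset by blast
  define b where "b = card V - Suc (card S) - i"
  have m: "k - card S = Suc m" using Suc.hyps(2) by simp
  \<comment> \<open>As \<open>card S < k\<close>, the hypothesis \<open>i + k <= card V\<close>
    makes this difference positive, so nothing is truncated.\<close>
  then have b: "card V - card S - i = Suc b"
    using ik by (simp add: b_def)
  have rb: "real (card V) - real (card S) - real i = Suc b" "real k - real (card S) = Suc m"
  proof -
    have "card V = card S + i + Suc b" "k = card S + Suc m"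
      using b m by linarith+
    then show "real (card V) - real (card S) - real i = Suc b" "real k - real (card S) = Suc m"
      by simp_all
  qed
  have "real (Suc m) * upper_sum V k (lift h i) S = (\<Sum>x\<in>V-S. upper_sum V k (lift h i) (insert x S))"
    using upper_sum_insert[OF V, of S k "lift h i"] Suc.prems(1) rb(2) by simp
  also have "\<dots> = (\<Sum>x\<in>V-S. real (b choose m) * lift h i (insert x S))"
  proof (intro sum.cong refl)
    fix x assume x: "x \<in> V - S"
    then have "card (insert x S) = Suc (card S)" "insert x S \<subseteq> V"
      using fS Suc.prems(1) by auto
    then show "upper_sum V k (lift h i) (insert x S) = real (b choose m) * lift h i (insert x S)"
      using Suc.hyps(1)[of "insert x S"] m diff_Suc[of k "card S"] by (simp add: b_def)
  qed
  also have "\<dots> = real (b choose m) * (real (Suc b) * lift h i S)"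
    using sum_lift_insert[OF V h, of S] Suc.prems(1) rb(1) by (simp flip: sum_distrib_left)
  also have "\<dots> = (real (Suc b) * real (b choose m)) * lift h i S" by simp
  also have "real (Suc b) * real (b choose m) = real (Suc m) * real (Suc b choose Suc m)"
    by (metis Suc_times_binomial of_nat_mult)
  finally show ?case
    unfolding b m by simp
qed

section \<open>Adjointness, complements and orthogonality of levels\<close>

lemma lift_eq_0: "finite T \<Longrightarrow> card T < i \<Longrightarrow> lift h i T = 0"
  by (simp add: lift_def nsets_eq_empty)

lemma lift_self:
  assumes "finite T"
  shows "lift h (card T) T = h T"
proof -
  have "X = T" if "X \<in> nsets T (card T)" for X
    using that assms card_subset_eq[of T X] by (auto simp: nsets_def)
  then have "nsets T (card T) = {T}"
    using assms by (auto simp: nsets_def)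
  then show ?thesis by (simp add: lift_def)
qed

text \<open>Adjointness of \<open>lift\<close> and \<open>upper_sum\<close>: both sides sum
  \<open>h R * f T\<close> over the pairs with \<open>R\<close> inside \<open>T\<close>.\<close>

lemma sum_lift_mult:
  assumes V: "finite V"
  shows "(\<Sum>T\<in>nsets V m. lift h i T * f T) = (\<Sum>R\<in>nsets V i. h R * upper_sum V m f R)"
proof -
  have "(\<Sum>T\<in>nsets V m. lift h i T * f T)
      = (\<Sum>T\<in>nsets V m. \<Sum>R\<in>nsets V i. if R \<subseteq> T then h R * f T else 0)"
  proof (intro sum.cong refl)
    fix T assume "T \<in> nsets V m"
    then have "{R \<in> nsets V i. R \<subseteq> T} = nsets T i" by (auto simp: nsets_def)
    then show "lift h i T * f T = (\<Sum>R\<in>nsets V i. if R \<subseteq> T then h R * f T else 0)"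
      using V by (simp add: lift_def sum_distrib_right flip: sum.inter_filter)
  qed
  also have "\<dots> = (\<Sum>R\<in>nsets V i. \<Sum>T\<in>nsets V m. if R \<subseteq> T then h R * f T else 0)"
    by (rule sum.swap)
  also have "\<dots> = (\<Sum>R\<in>nsets V i. h R * upper_sum V m f R)"
    using V by (simp add: upper_sum_def sum_distrib_left flip: sum.inter_filter)
  finally show ?thesis .
qed

text \<open>Adjointness against the constant 1: all \<open>i\<close>-subsets of \<open>U\<close> lie
  in equally many \<open>m\<close>-subsets.\<close>

lemma sum_lift:
  assumes "finite U" "i \<le> m"
  shows "(\<Sum>B\<in>nsets U m. lift h i B) = real ((card U - i) choose (m - i)) * lift h i U"
proof -
  have "upper_sum U m (\<lambda>_. 1) R = real ((card U - i) choose (m - i))" if "R \<in> nsets U i" for R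
    using that assms card_nsets_supset[of U R m] by (simp add: upper_sum_def nsets_def)
  then have "(\<Sum>R\<in>nsets U i. h R * upper_sum U m (\<lambda>_. 1) R) = real ((card U - i) choose (m - i)) * lift h i U"
    unfolding lift_def sum_distrib_left by (intro sum.cong) auto
  then show ?thesis
    using sum_lift_mult[OF assms(1), of h i "\<lambda>_. 1" m] by simp
qed

lemma sum_Pow_alternating:
  assumes "finite U"
  shows "(\<Sum>Z\<in>Pow U. (-1) ^ card Z) = (if U = {} then 1 else (0::real))"
proof (cases "U = {}")
  case False
  with assms have "card {T. T \<subseteq> U \<and> {} \<subseteq> T \<and> even (card T)} = card {T. T \<subseteq> U \<and> {} \<subseteq> T \<and> odd (card T)}"
    by (intro card_subsupersets_even_odd) auto
  with assms False show ?thesis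
    by (simp add: sum_alternating_cancels)
qed auto

text \<open>By inclusion-exclusion the condition that \<open>R\<close> avoids \<open>T\<close>
  becomes an alternating sum of upper sums of \<open>h\<close> over all \<open>Z\<close> inside
  \<open>T\<close>, and only those at \<open>i\<close>-sets survive.\<close>

lemma lift_complement:
  assumes V: "finite V" and h: "harmonic V i h" and i: "2 * i \<le> card V" and T: "T \<subseteq> V"
  shows "lift h i (V - T) = (-1) ^ i * lift h i T"
proof -
  have fT: "finite T" using V T finite_subset by blast
  \<comment> \<open>Below size \<open>i\<close> harmonicity gives zero, as the lift is an empty sum
    there; above size \<open>i\<close> there are no supersets.\<close>
  have upper: "upper_sum V i h Z = (if card Z = i then h Z else 0)" if Z: "Z \<subseteq> T" for Z
  proof -
    have fZ: "finite Z" and ZV: "Z \<subseteq> V" using Z fT finite_subset T by blast+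
    have eq: "upper_sum V i h Z = upper_sum V i (lift h i) Z"
      unfolding upper_sum_def
    proof (intro sum.cong refl)
      fix S assume "S \<in> {T \<in> nsets V i. Z \<subseteq> T}"
      then have "finite S" "card S = i" by (auto simp: nsets_def)
      then show "h S = lift h i S" using lift_self[of S h] by simp
    qed
    consider "card Z < i" | "card Z = i" | "card Z > i" by linarith
    then show ?thesis
    proof cases
      case 1
      then show ?thesis
        using upper_sum_lift[OF V h _ ZV, of i] i eq fZ by (simp add: lift_eq_0)
    next
      case 2
      then show ?thesis
        using upper_sum_self[of V Z i h] V ZV fZ by (simp add: nsets_def)
    next
      case 3
      then have "{S \<in> nsets V i. Z \<subseteq> S} = {}"
        by (auto simp: nsets_def) (metis card_mono leD)
      with 3 show ?thesis by (simp only: upper_sum_def sum.empty) simp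
    qed
  qed
  have "nsets (V - T) i = {R \<in> nsets V i. R \<inter> T = {}}"
    by (auto simp: nsets_def)
  then have "lift h i (V - T) = (\<Sum>R\<in>nsets V i. if R \<inter> T = {} then h R else 0)"
    using V unfolding lift_def by (simp only: sum.inter_filter finite_imp_finite_nsets)
  also have "\<dots> = (\<Sum>R\<in>nsets V i. h R * (if T \<inter> R = {} then 1 else 0))"
    by (intro sum.cong) auto
  also have "\<dots> = (\<Sum>R\<in>nsets V i. h R * (\<Sum>Z\<in>Pow (T \<inter> R). (-1) ^ card Z))"
    using fT by (simp add: sum_Pow_alternating del: Pow_Int_eq)
  also have "\<dots> = (\<Sum>R\<in>nsets V i. \<Sum>Z\<in>Pow T. if Z \<subseteq> R then (-1) ^ card Z * h R else 0)"
  proof (intro sum.cong refl)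
    fix R
    have "Pow (T \<inter> R) = {Z \<in> Pow T. Z \<subseteq> R}" by auto
    then show "h R * (\<Sum>Z\<in>Pow (T \<inter> R). (-1) ^ card Z) = (\<Sum>Z\<in>Pow T. if Z \<subseteq> R then (-1) ^ card Z * h R else 0)"
      using fT by (simp add: sum_distrib_left mult.commute flip: sum.inter_filter)
  qed
  also have "\<dots> = (\<Sum>Z\<in>Pow T. \<Sum>R\<in>nsets V i. if Z \<subseteq> R then (-1) ^ card Z * h R else 0)"
    by (rule sum.swap)
  also have "\<dots> = (\<Sum>Z\<in>Pow T. (-1) ^ card Z * upper_sum V i h Z)"
    using V by (simp add: upper_sum_def sum_distrib_left flip: sum.inter_filter)
  also have "\<dots> = (\<Sum>Z\<in>Pow T. if card Z = i then (-1) ^ i * h Z else 0)"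
    by (intro sum.cong) (auto simp: upper)
  also have "\<dots> = (-1) ^ i * lift h i T"
  proof -
    have "{Z \<in> Pow T. card Z = i} = nsets T i"
      using fT finite_subset by (auto simp: nsets_def)
    then show ?thesis
      using fT by (simp add: lift_def sum_distrib_left flip: sum.inter_filter)
  qed
  finally show ?thesis .
qed

text \<open>The \<open>m\<close>-sets disjoint from \<open>T\<close> are the
  \<open>m\<close>-subsets of its complement: \<open>sum_lift\<close> supplies the binomial,
  \<open>lift_complement\<close> the sign.\<close>

lemma kneser_lift:
  assumes V: "finite V" and h: "harmonic V i h" and i: "i \<le> m" "2 * m \<le> card V"
    and T: "T \<in> nsets V m"
  shows "(\<Sum>B\<in>nsets (V - T) m. lift h i B) = (-1) ^ i * real ((card V - m - i) choose (m - i)) * lift h i T"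
proof -
  have "T \<subseteq> V" "finite T" "card T = m" using T by (auto simp: nsets_def)
  then show ?thesis
    using V i by (simp add: sum_lift lift_complement[OF V h] card_Diff_subset)
qed

text \<open>Adjointness reduces this to the upper sum of the higher-level lift at sets smaller than
  its level, which is zero by \<open>upper_sum_lift\<close>.\<close>

lemma sum_lift_lift_neq:
  assumes V: "finite V" and h: "harmonic V i h" "harmonic V j g" and "i \<noteq> j" "i \<le> m" "j \<le> m" "2 * m \<le> card V"
  shows "(\<Sum>T\<in>nsets V m. lift h i T * lift g j T) = 0"
proof -
  have *: "(\<Sum>T\<in>nsets V m. lift h i T * lift g j T) = 0"
    if "i < j" "i \<le> m" "j \<le> m" "harmonic V j g" for i j :: nat and g h :: "'a set \<Rightarrow> real"
    unfolding sum_lift_mult[OF V]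
  proof (intro sum.neutral ballI)
    fix R assume "R \<in> nsets V i"
    then show "h R * upper_sum V m (lift g j) R = 0"
      using that assms upper_sum_lift[OF V, of j g m R] by (auto simp: nsets_def lift_eq_0)
  qed
  show ?thesis
    using *[of i j g h] *[of j i h g] h assms by (cases "i < j") (auto simp: mult.commute)
qed

lemma sum_lift_sq:
  assumes V: "finite V" and h: "harmonic V i h" and "i \<le> m" "2 * m \<le> card V"
  shows "(\<Sum>T\<in>nsets V m. lift h i T * lift h i T)
    = real ((card V - 2 * i) choose (m - i)) * (\<Sum>R\<in>nsets V i. (h R)\<^sup>2)"
proof -
  have "(\<Sum>T\<in>nsets V m. lift h i T * lift h i T) = (\<Sum>R\<in>nsets V i. real ((card V - 2 * i) choose (m - i)) * (h R)\<^sup>2)"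
    unfolding sum_lift_mult[OF V]
  proof (intro sum.cong refl)
    fix R assume "R \<in> nsets V i"
    then show "h R * upper_sum V m (lift h i) R = real ((card V - 2 * i) choose (m - i)) * (h R)\<^sup>2"
      using assms upper_sum_lift[OF V h, of m R] lift_self[of R h]
      by (auto simp: nsets_def power2_eq_square mult_2)
  qed
  then show ?thesis by (simp add: sum_distrib_left)
qed

lemma sum_levels_mult:
  assumes V: "finite V" and h: "\<And>i. i \<le> m \<Longrightarrow> harmonic V i (h i)" and m: "2 * m \<le> card V"
  shows "(\<Sum>T\<in>nsets V m. (\<Sum>i\<le>m. a i * lift (h i) i T) * (\<Sum>i\<le>m. b i * lift (h i) i T))
    = (\<Sum>i\<le>m. a i * b i * (real ((card V - 2 * i) choose (m - i)) * (\<Sum>R\<in>nsets V i. (h i R)\<^sup>2)))"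
proof -
  have "(\<Sum>T\<in>nsets V m. (\<Sum>i\<le>m. a i * lift (h i) i T) * (\<Sum>j\<le>m. b j * lift (h j) j T))
     = (\<Sum>T\<in>nsets V m. \<Sum>i\<le>m. \<Sum>j\<le>m. a i * b j * (lift (h i) i T * lift (h j) j T))"
    unfolding sum_product by (intro sum.cong refl) simp
  also have "\<dots> = (\<Sum>i\<le>m. \<Sum>j\<le>m. a i * b j * (\<Sum>T\<in>nsets V m. lift (h i) i T * lift (h j) j T))"
    unfolding sum_distrib_left by (subst sum.swap, intro sum.cong refl, rule sum.swap)
  also have "\<dots> = (\<Sum>i\<le>m. \<Sum>j\<le>m. if j = i then a i * b i * (\<Sum>T\<in>nsets V m. lift (h i) i T * lift (h i) i T) else 0)"
  proof (intro sum.cong refl)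
    fix i j assume "i \<in> {..m}" "j \<in> {..m}"
    then show "a i * b j * (\<Sum>T\<in>nsets V m. lift (h i) i T * lift (h j) j T)
      = (if j = i then a i * b i * (\<Sum>T\<in>nsets V m. lift (h i) i T * lift (h i) i T) else 0)"
      using sum_lift_lift_neq[OF V h h, of i j m] m by auto
  qed
  also have "\<dots> = (\<Sum>i\<le>m. a i * b i * (\<Sum>T\<in>nsets V m. lift (h i) i T * lift (h i) i T))"
    by simp
  also have "\<dots> = (\<Sum>i\<le>m. a i * b i * (real ((card V - 2 * i) choose (m - i)) * (\<Sum>R\<in>nsets V i. (h i R)\<^sup>2)))"
    using sum_lift_sq[OF V h _ m] by (intro sum.cong refl) simp
  finally show ?thesis .
qed

text \<open>Induction on \<open>k\<close>: decompose the image \<open>Df\<close> of \<open>f\<close>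
  on the smaller sets. By \<open>sum_lift_insert\<close> the down map acts on each lower level as a
  scalar, so dividing by it pulls the decomposition back. What is left of \<open>f\<close> is killed
  by the down map, hence harmonic of level \<open>Suc k\<close>.\<close>

lemma harmonic_decomposition:
  assumes V: "finite V"
  shows "2 * k \<le> card V \<Longrightarrow> \<exists>h. (\<forall>i\<le>k. harmonic V i (h i)) \<and> (\<forall>T\<in>nsets V k. f T = (\<Sum>i\<le>k. lift (h i) i T))"
proof (induction k arbitrary: f)
  case 0
  show ?case
    by (rule exI[of _ "\<lambda>_. f"]) (auto simp: harmonic_def lift_def)
next
  case (Suc k)
  define Df where "Df S = (\<Sum>x\<in>V-S. f (insert x S))" for S
  obtain g where g: "\<And>i. i \<le> k \<Longrightarrow> harmonic V i (g i)"
    and Df: "\<And>S. S \<in> nsets V k \<Longrightarrow> Df S = (\<Sum>i\<le>k. lift (g i) i S)"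
    using Suc.IH[of Df] Suc.prems by auto
  \<comment> \<open>The divisors are positive for \<open>i <= k\<close> because
    \<open>2 * Suc k <= card V\<close>.\<close>
  define h where "h i = (if i \<le> k then (\<lambda>R. g i R / (real (card V) - real k - real i))
    else (\<lambda>T. f T - (\<Sum>i\<le>k. lift (g i) i T / (real (card V) - real k - real i))))" for i
  have lift_h: "lift (h i) i T = lift (g i) i T / (real (card V) - real k - real i)" if "i \<le> k" for i T
    using that by (simp add: h_def lift_def sum_divide_distrib)
  have "harmonic V i (h i)" if "i \<le> Suc k" for i
  proof (cases "i \<le> k")
    case True
    with g[OF this] show ?thesis by (simp add: harmonic_def h_def flip: sum_divide_distrib)
  next
    case False
    then have i: "i = Suc k" using that by simp
    show ?thesis unfolding harmonic_def
    proof (intro allI impI)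
      fix S assume S: "S \<subseteq> V" "Suc (card S) = i"
      then have SV: "S \<in> nsets V k" using i V finite_subset by (auto simp: nsets_def)
      have "(\<Sum>x\<in>V-S. h i (insert x S))
          = Df S - (\<Sum>i\<le>k. (\<Sum>x\<in>V-S. lift (g i) i (insert x S)) / (real (card V) - real k - real i))"
        by (simp add: i h_def Df_def sum_subtractf sum_divide_distrib, rule sum.swap)
      also have "(\<Sum>i\<le>k. (\<Sum>x\<in>V-S. lift (g i) i (insert x S)) / (real (card V) - real k - real i))
          = (\<Sum>i\<le>k. lift (g i) i S)"
      proof (intro sum.cong refl)
        fix j assume "j \<in> {..k}"
        then show "(\<Sum>x\<in>V-S. lift (g j) j (insert x S)) / (real (card V) - real k - real j) = lift (g j) j S"
          using sum_lift_insert[OF V g[of j] S(1)] S i Suc.prems by simp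
      qed
      finally show "(\<Sum>x\<in>V-S. h i (insert x S)) = 0"
        using Df[OF SV] by simp
    qed
  qed
  moreover have "f T = (\<Sum>i\<le>Suc k. lift (h i) i T)" if "T \<in> nsets V (Suc k)" for T
  proof -
    have "lift (h (Suc k)) (Suc k) T = h (Suc k) T"
      using that lift_self[of T] by (auto simp: nsets_def)
    then show ?thesis by (simp add: lift_h) (simp add: h_def)
  qed
  ultimately show ?case by blast
qed

subsection \<open>Quadratic forms of an intersecting family\<close>

text \<open>Orthogonality of levels plus the eigenvalues from \<open>kneser_lift\<close>. The
  weights \<open>a\<close> leave room for the factors that the levels acquire when summed down from
  \<open>k\<close>-sets to \<open>d\<close>-sets.\<close>

lemma kneser_form:
  assumes V: "finite V" and h: "\<And>i. i \<le> m \<Longrightarrow> harmonic V i (h i)" and m: "2 * m \<le> card V"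
    and f: "\<And>T. T \<in> nsets V m \<Longrightarrow> f T = (\<Sum>i\<le>m. a i * lift (h i) i T)"
  shows "(\<Sum>T\<in>nsets V m. f T * (\<Sum>B\<in>nsets (V - T) m. f B))
    = (\<Sum>i\<le>m. (-1) ^ i * real ((card V - m - i) choose (m - i)) * (a i)\<^sup>2 *
        (real ((card V - 2 * i) choose (m - i)) * (\<Sum>R\<in>nsets V i. (h i R)\<^sup>2)))"
proof -
  define b where "b i = a i * ((-1) ^ i * real ((card V - m - i) choose (m - i)))" for i
  have "(\<Sum>B\<in>nsets (V - T) m. f B) = (\<Sum>i\<le>m. b i * lift (h i) i T)" if T: "T \<in> nsets V m" for T
  proof -
    have "(\<Sum>B\<in>nsets (V - T) m. f B) = (\<Sum>B\<in>nsets (V - T) m. \<Sum>i\<le>m. a i * lift (h i) i B)"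
      using nsets_mono[of "V - T" V m] by (intro sum.cong f) auto
    also have "\<dots> = (\<Sum>i\<le>m. a i * (\<Sum>B\<in>nsets (V - T) m. lift (h i) i B))"
      unfolding sum_distrib_left by (rule sum.swap)
    also have "\<dots> = (\<Sum>i\<le>m. b i * lift (h i) i T)"
      using kneser_lift[OF V h _ m T] by (intro sum.cong) (auto simp: b_def)
    finally show ?thesis .
  qed
  then have "(\<Sum>T\<in>nsets V m. f T * (\<Sum>B\<in>nsets (V - T) m. f B))
    = (\<Sum>T\<in>nsets V m. (\<Sum>i\<le>m. a i * lift (h i) i T) * (\<Sum>i\<le>m. b i * lift (h i) i T))"
    using f by simp
  also have "\<dots> = (\<Sum>i\<le>m. a i * b i * (real ((card V - 2 * i) choose (m - i)) * (\<Sum>R\<in>nsets V i. (h i R)\<^sup>2)))"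
    by (rule sum_levels_mult[OF V h m])
  also have "\<dots> = (\<Sum>i\<le>m. (-1) ^ i * real ((card V - m - i) choose (m - i)) * (a i)\<^sup>2 *
        (real ((card V - 2 * i) choose (m - i)) * (\<Sum>R\<in>nsets V i. (h i R)\<^sup>2)))"
    by (intro sum.cong) (auto simp: b_def power2_eq_square)
  finally show ?thesis .
qed

text \<open>Up to the sign \<open>(-1)^i\<close>, these are the eigenvalues on level \<open>i\<close> of the disjointness matrix \<open>A\<close> of
  the \<open>k\<close>-sets and of \<open>W\<^sup>T A' W\<close>, where \<open>W\<close> maps a function on \<open>k\<close>-sets to its \<open>d\<close>-degrees and \<open>A'\<close> is the
  disjointness matrix of the \<open>d\<close>-sets. The case distinction is needed since \<open>d - i\<close> truncates to \<open>0\<close>,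
  whereas \<open>W\<close> vanishes on the levels above \<open>d\<close>.\<close>

definition kneser_ev :: "nat \<Rightarrow> nat \<Rightarrow> nat \<Rightarrow> real" where
  "kneser_ev n k i = real ((n - k - i) choose (k - i))"

definition degree_ev :: "nat \<Rightarrow> nat \<Rightarrow> nat \<Rightarrow> nat \<Rightarrow> real" where
  "degree_ev n k d i = (if i \<le> d
    then real ((n - d - i) choose (d - i)) * real ((k - i) choose (d - i)) * real ((n - d - i) choose (k - d))
    else 0)"

lemma sum_atMost_split:
  fixes f :: "nat \<Rightarrow> real"
  shows "(\<Sum>i\<le>d. f i) = f 0 + (\<Sum>i=1..d. f i)"
  by (simp add: atMost_atLeast0 sum.atLeast_Suc_atMost)

text \<open>Converts the squared norm of a level on the \<open>d\<close>-sets into that on the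
  \<open>k\<close>-sets, so that both quadratic forms can be written in the same unknowns.\<close>

lemma level_weight_mult:
  assumes "i \<le> d" "d \<le> k" "2 * k \<le> n"
  shows "real ((n - d - i) choose (k - d)) * real ((n - 2 * i) choose (d - i))
    = real ((k - i) choose (d - i)) * real ((n - 2 * i) choose (k - i))"
proof -
  have "((n - 2 * i) choose (k - i)) * ((k - i) choose (d - i)) =
      ((n - 2 * i) choose (d - i)) * ((n - 2 * i - (d - i)) choose (k - i - (d - i)))"
    using assms by (intro choose_mult) auto
  moreover have "n - 2 * i - (d - i) = n - d - i" "k - i - (d - i) = k - d"
    using assms by auto
  ultimately show ?thesis
    by (metis mult.commute of_nat_mult)
qed

text \<open>Passes from sets to numbers: \<open>X i\<close> is the squared norm of the
  level-\<open>i\<close> component of the indicator function. The last fact sums the positive excess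
  degrees over all \<open>d\<close>-sets and their products over disjoint pairs.\<close>

lemma intersecting_spectrum:
  assumes V: "finite V" and k: "2 * k \<le> card V" and F: "F \<subseteq> nsets V k" and int: "intersecting F"
    and N: "N = real (card V choose k)" and p: "p = real (card F) / N"
  obtains X where "\<And>i. i \<le> k \<Longrightarrow> X i \<ge> 0" "X 0 = N * p\<^sup>2" "(\<Sum>i\<le>k. X i) = N * p"
    "(\<Sum>i\<le>k. (-1) ^ i * kneser_ev (card V) k i * X i) = 0"
    "\<And>d c. d \<le> k \<Longrightarrow>
      (\<And>S. S \<in> nsets V d \<Longrightarrow> real (set_degree S F) > c * real ((card V - d) choose (k - d))) \<Longrightarrow>
      p > c \<and> degree_ev (card V) k d 0 * N * (p - c)\<^sup>2 + (\<Sum>i=1..d. (-1) ^ i * degree_ev (card V) k d i * X i) > 0"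
proof -
  let ?n = "card V"
  define f :: "'a set \<Rightarrow> real" where "f T = (if T \<in> F then 1 else 0)" for T
  have finF: "finite F" using F V finite_subset by fastforce
  have N0: "N > 0" using k by (simp add: N)
  obtain h where h: "\<And>i. i \<le> k \<Longrightarrow> harmonic V i (h i)"
    and f: "\<And>T. T \<in> nsets V k \<Longrightarrow> f T = (\<Sum>i\<le>k. lift (h i) i T)"
    using harmonic_decomposition[OF V k, of f] by blast
  have upper: "upper_sum V k f S = (\<Sum>i\<le>d. real ((?n - d - i) choose (k - d)) * lift (h i) i S)"
    if S: "S \<in> nsets V d" and d: "d \<le> k" for S d
  proof -
    have S': "S \<subseteq> V" "finite S" "card S = d" using S by (auto simp: nsets_def)
    have "upper_sum V k f S = (\<Sum>T\<in>{T\<in>nsets V k. S \<subseteq> T}. \<Sum>i\<le>k. lift (h i) i T)"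
      unfolding upper_sum_def by (intro sum.cong f) auto
    also have "\<dots> = (\<Sum>i\<le>k. upper_sum V k (lift (h i) i) S)"
      unfolding upper_sum_def by (rule sum.swap)
    also have "\<dots> = (\<Sum>i\<le>k. real ((?n - d - i) choose (k - d)) * lift (h i) i S)"
      using upper_sum_lift[OF V h, of _ k S] k d S' by (intro sum.cong) auto
    also have "\<dots> = (\<Sum>i\<le>d. real ((?n - d - i) choose (k - d)) * lift (h i) i S)"
      using d S' by (intro sum.mono_neutral_right) (auto simp: lift_eq_0)
    finally show ?thesis .
  qed
  have upper_f: "upper_sum V k f S = real (set_degree S F)" for S
  proof -
    have "{T \<in> {T\<in>nsets V k. S \<subseteq> T}. T \<in> F} = {T\<in>F. S \<subseteq> T}"
      using F by auto
    moreover have "finite {T\<in>nsets V k. S \<subseteq> T}" using V by simp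
    ultimately have "upper_sum V k f S = (\<Sum>T\<in>{T\<in>F. S \<subseteq> T}. 1)"
      unfolding upper_sum_def f_def by (simp only: flip: sum.inter_filter)
    then show ?thesis by (simp add: set_degree_def)
  qed
  \<comment> \<open>The degree of the empty set is the size of the family, and only level 0
    contributes to it.\<close>
  have h0: "h 0 {} = p"
    using upper[of "{}" 0] upper_f[of "{}"] V N0 by (simp add: lift_def set_degree_def p N field_simps)
  define X where "X i = real ((?n - 2 * i) choose (k - i)) * (\<Sum>R\<in>nsets V i. (h i R)\<^sup>2)" for i
  show thesis
  proof (rule that[of X])
    show "X i \<ge> 0" for i by (simp add: X_def sum_nonneg)
    show "X 0 = N * p\<^sup>2" by (simp add: X_def h0 N)
    have "(\<Sum>i\<le>k. X i) = (\<Sum>T\<in>nsets V k. f T * f T)"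
      using sum_levels_mult[OF V h k, where a = "\<lambda>_. 1" and b = "\<lambda>_. 1"] f by (simp add: X_def)
    also have "\<dots> = (\<Sum>T\<in>nsets V k. if T \<in> F then 1 else 0)"
      by (intro sum.cong) (auto simp: f_def)
    also have "\<dots> = real (card F)"
      using V F by (simp add: Int_absorb1 flip: sum.inter_restrict)
    finally show "(\<Sum>i\<le>k. X i) = N * p" using N0 by (simp add: p)
    have zero: "f T * (\<Sum>B\<in>nsets (V - T) k. f B) = 0" for T
    proof (cases "T \<in> F")
      case True
      have "B \<notin> F" if "B \<in> nsets (V - T) k" for B
        using int True that by (auto simp: intersecting_def nsets_def)
      then show ?thesis by (simp add: f_def)
    qed (simp add: f_def)
    have "0 = (\<Sum>T\<in>nsets V k. f T * (\<Sum>B\<in>nsets (V - T) k. f B))"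
      by (simp only: zero sum.neutral_const)
    also have "\<dots> = (\<Sum>i\<le>k. (-1) ^ i * kneser_ev ?n k i * X i)"
      using kneser_form[OF V h k, of f "\<lambda>_. 1"] by (simp add: f X_def kneser_ev_def)
    finally show "(\<Sum>i\<le>k. (-1) ^ i * kneser_ev ?n k i * X i) = 0" by simp
  next
    fix d c
    assume d: "d \<le> k" and deg: "\<And>S. S \<in> nsets V d \<Longrightarrow> real (set_degree S F) > c * real ((?n - d) choose (k - d))"
    define g where "g S = upper_sum V k f S - c * real ((?n - d) choose (k - d))" for S
    \<comment> \<open>Subtracting a constant from the degrees changes level 0 only.\<close>
    define h' where "h' i = (if i = 0 then (\<lambda>R. h 0 R - c) else h i)" for i
    define w where "w i = real ((?n - d - i) choose (k - d))" for i
    have d2: "2 * d \<le> ?n" using d k by simp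
    have h': "harmonic V i (h' i)" if "i \<le> d" for i
      using h[of i] that d by (auto simp: h'_def harmonic_def)
    have g: "g S = (\<Sum>i\<le>d. w i * lift (h' i) i S)" if "S \<in> nsets V d" for S
    proof -
      have "(\<Sum>i\<le>d. w i * lift (h' i) i S) = (\<Sum>i\<le>d. w i * lift (h i) i S) - w 0 * c"
        by (simp add: sum.atMost_shift h'_def lift_def algebra_simps)
      then show ?thesis
        using upper[OF that d] by (simp add: g_def w_def)
    qed
    have gpos: "g S > 0" if "S \<in> nsets V d" for S
      using deg[OF that] by (simp add: g_def upper_f)
    \<comment> \<open>Strict positivity of the form requires that every \<open>d\<close>-set has a
      \<open>d\<close>-set disjoint from it.\<close>
    have ne: "nsets (V - T) d \<noteq> {}" if "T \<in> nsets V d" for T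
    proof -
      have "T \<subseteq> V" "finite T" "card T = d" using that by (auto simp: nsets_def)
      then have "d \<le> card (V - T)" using d2 by (simp add: card_Diff_subset)
      then show ?thesis by (simp add: nsets_eq_empty_iff)
    qed
    have inner: "0 < (\<Sum>B\<in>nsets (V - T) d. g B)" if "T \<in> nsets V d" for T
    proof (rule sum_pos)
      fix B assume "B \<in> nsets (V - T) d"
      then have "B \<in> nsets V d" using nsets_mono[of "V - T" V d] by blast
      then show "0 < g B" by (rule gpos)
    qed (use V ne[OF that] in auto)
    have "0 < (\<Sum>T\<in>nsets V d. g T * (\<Sum>B\<in>nsets (V - T) d. g B))"
    proof (rule sum_pos)
      show "nsets V d \<noteq> {}" using d2 V by (auto simp: nsets_eq_empty_iff)
      show "0 < g T * (\<Sum>B\<in>nsets (V - T) d. g B)" if "T \<in> nsets V d" for T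
        using gpos[OF that] inner[OF that] by (rule mult_pos_pos)
    qed (use V in simp)
    also have "\<dots> = (\<Sum>i\<le>d. (-1) ^ i * real ((?n - d - i) choose (d - i)) * (w i)\<^sup>2 *
        (real ((?n - 2 * i) choose (d - i)) * (\<Sum>R\<in>nsets V i. (h' i R)\<^sup>2)))"
      by (rule kneser_form[OF V h' d2 g])
    also have "\<dots> = (\<Sum>i\<le>d. (-1) ^ i * degree_ev ?n k d i *
        (real ((?n - 2 * i) choose (k - i)) * (\<Sum>R\<in>nsets V i. (h' i R)\<^sup>2)))"
    proof (rule sum.cong[OF refl])
      fix i assume "i \<in> {..d}"
      then have "w i * real ((?n - 2 * i) choose (d - i)) = real ((k - i) choose (d - i)) * real ((?n - 2 * i) choose (k - i))"
        and i: "i \<le> d"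
        using level_weight_mult[of i d k ?n] d k by (auto simp: w_def)
      then have "(w i)\<^sup>2 * real ((?n - 2 * i) choose (d - i)) = w i * real ((k - i) choose (d - i)) * real ((?n - 2 * i) choose (k - i))"
        by (simp add: power2_eq_square mult.assoc)
      then show "(-1) ^ i * real ((?n - d - i) choose (d - i)) * (w i)\<^sup>2 *
          (real ((?n - 2 * i) choose (d - i)) * (\<Sum>R\<in>nsets V i. (h' i R)\<^sup>2))
        = (-1) ^ i * degree_ev ?n k d i * (real ((?n - 2 * i) choose (k - i)) * (\<Sum>R\<in>nsets V i. (h' i R)\<^sup>2))"
        using i by (simp add: degree_ev_def) (simp add: w_def)
    qed
    also have "\<dots> = degree_ev ?n k d 0 * N * (p - c)\<^sup>2 + (\<Sum>i=1..d. (-1) ^ i * degree_ev ?n k d i *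
        (real ((?n - 2 * i) choose (k - i)) * (\<Sum>R\<in>nsets V i. (h' i R)\<^sup>2)))"
      unfolding sum_atMost_split by (simp add: h'_def h0 N)
    also have "(\<Sum>i=1..d. (-1) ^ i * degree_ev ?n k d i *
        (real ((?n - 2 * i) choose (k - i)) * (\<Sum>R\<in>nsets V i. (h' i R)\<^sup>2)))
      = (\<Sum>i=1..d. (-1) ^ i * degree_ev ?n k d i * X i)"
      by (intro sum.cong) (auto simp: h'_def X_def)
    finally have form: "degree_ev ?n k d 0 * N * (p - c)\<^sup>2 + (\<Sum>i=1..d. (-1) ^ i * degree_ev ?n k d i * X i) > 0" .
    have "0 < (\<Sum>S\<in>nsets V d. g S)"
      using d2 V gpos by (intro sum_pos) (auto simp: nsets_eq_empty_iff)
    also have "\<dots> = (\<Sum>S\<in>nsets V d. \<Sum>i\<le>d. w i * lift (h' i) i S)"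
      by (intro sum.cong g) auto
    also have "\<dots> = (\<Sum>i\<le>d. w i * (\<Sum>S\<in>nsets V d. lift (h' i) i S))"
      unfolding sum_distrib_left by (rule sum.swap)
    also have "\<dots> = (\<Sum>i\<le>d. if i = 0 then w 0 * real (?n choose d) * (p - c) else 0)"
    proof (rule sum.cong[OF refl])
      fix i assume i: "i \<in> {..d}"
      \<comment> \<open>For \<open>i > 0\<close> the right-hand side is an empty sum, so only level
        0 contributes to the total excess.\<close>
      then have "lift (h' i) i V = (-1) ^ i * lift (h' i) i {}"
        using lift_complement[OF V h', of i "{}"] d2 by simp
      then show "w i * (\<Sum>S\<in>nsets V d. lift (h' i) i S) = (if i = 0 then w 0 * real (?n choose d) * (p - c) else 0)"
        using i V by (auto simp: sum_lift lift_eq_0) (simp add: lift_def h'_def h0)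
    qed
    also have "\<dots> = w 0 * real (?n choose d) * (p - c)"
      by simp
    finally have "0 < w 0 * real (?n choose d) * (p - c)" .
    moreover have "w 0 * real (?n choose d) \<ge> 0" by (simp add: w_def)
    ultimately have "p > c"
      using mult_nonneg_nonpos[of "w 0 * real (?n choose d)" "p - c"] by linarith
    with form show "p > c \<and> degree_ev ?n k d 0 * N * (p - c)\<^sup>2 + (\<Sum>i=1..d. (-1) ^ i * degree_ev ?n k d i * X i) > 0"
      by blast
  qed
qed

subsection \<open>Eigenvalue ratios\<close>

lemma kneser_ev_Suc:
  assumes "i < k" "2 * k \<le> n"
  shows "(real n - real k - real i) * kneser_ev n k (Suc i) = (real k - real i) * kneser_ev n k i"
proof -
  define a b where "a = n - k - Suc i" and "b = k - Suc i"
  have "n - k - i = Suc a" "k - i = Suc b" "n - k - Suc i = a" "k - Suc i = b"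
    using assms by (auto simp: a_def b_def)
  moreover have "real (Suc a) * real (a choose b) = real (Suc b) * real (Suc a choose Suc b)"
    by (metis Suc_times_binomial of_nat_mult)
  moreover have "real n - real k - real i = real (n - k - i)" "real k - real i = real (k - i)"
    using assms by auto
  ultimately show ?thesis
    by (simp only: kneser_ev_def)
qed

text \<open>Each of the three binomials in \<open>degree_ev\<close> changes by one absorption
  step.\<close>

lemma degree_ev_Suc:
  assumes "i < d" "d < k" "2 * k \<le> n"
  shows "(real n - real d - real i)\<^sup>2 * (real k - real i) * degree_ev n k d (Suc i)
    = (real d - real i)\<^sup>2 * (real n - real k - real i) * degree_ev n k d i"
proof -
  define a b c where "a = n - d - Suc i" and "b = d - Suc i" and "c = k - Suc i"
  have abc: "n - d - i = Suc a" "d - i = Suc b" "k - i = Suc c" "n - k - i = Suc a - (k - d)"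
    using assms by (auto simp: a_def b_def c_def)
  have 1: "real (Suc a) * real (a choose b) = real (Suc b) * real (Suc a choose Suc b)"
    by (metis Suc_times_binomial of_nat_mult)
  have 2: "real (Suc c) * real (c choose b) = real (Suc b) * real (Suc c choose Suc b)"
    by (metis Suc_times_binomial of_nat_mult)
  have 3: "real (Suc a) * real (a choose (k - d)) = real (Suc a - (k - d)) * real (Suc a choose (k - d))"
    using binomial_absorb_comp[of "Suc a" "k - d"] by (metis diff_Suc_1 of_nat_mult)
  have r: "real n - real d - real i = real (Suc a)" "real k - real i = real (Suc c)"
      "real d - real i = real (Suc b)" "real n - real k - real i = real (Suc a - (k - d))"
    using assms unfolding abc[symmetric] by auto
  have "(real (Suc a))\<^sup>2 * real (Suc c) * (real (a choose b) * real (c choose b) * real (a choose (k - d)))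
     = (real (Suc a) * real (a choose b)) * (real (Suc c) * real (c choose b)) * (real (Suc a) * real (a choose (k - d)))"
    by (simp only: power2_eq_square ac_simps)
  also have "\<dots> = (real (Suc b))\<^sup>2 * real (Suc a - (k - d)) *
      (real (Suc a choose Suc b) * real (Suc c choose Suc b) * real (Suc a choose (k - d)))"
    unfolding 1 2 3 by (simp only: power2_eq_square ac_simps)
  finally show ?thesis
    using assms unfolding r degree_ev_def abc by (simp only: a_def[symmetric] b_def[symmetric] c_def[symmetric]) simp
qed

definition kneser_ratio :: "nat \<Rightarrow> nat \<Rightarrow> nat \<Rightarrow> real" where
  "kneser_ratio n k j = (real k - real j) / (real n - real k - real j)"

text \<open>The factor vanishing at \<open>j = d\<close> lets products of these ratios reproduce the
  zero levels of \<open>degree_ev\<close> above \<open>d\<close>.\<close>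

definition degree_ratio :: "nat \<Rightarrow> nat \<Rightarrow> nat \<Rightarrow> nat \<Rightarrow> real" where
  "degree_ratio n k d j = (real d - real j)\<^sup>2 * (real n - real k - real j) / ((real n - real d - real j)\<^sup>2 * (real k - real j))"

lemma kneser_ev_eq:
  assumes "1 \<le> i" "i \<le> k" "2 * k \<le> n"
  shows "kneser_ev n k i = kneser_ev n k 1 * (\<Prod>j=1..<i. kneser_ratio n k j)"
  using assms(1,2)
proof (induction i rule: dec_induct)
  case (step i)
  then have "real n - real k - real i > 0" using assms(3) by simp
  then have "kneser_ev n k (Suc i) = kneser_ratio n k i * kneser_ev n k i"
    using kneser_ev_Suc[of i k n] step assms by (simp add: kneser_ratio_def field_simps)
  with step show ?case by (simp add: mult_ac)
qed simp

lemma degree_ev_eq: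
  assumes "1 \<le> i" "i \<le> k" "d < k" "2 * k \<le> n"
  shows "degree_ev n k d i = degree_ev n k d 1 * (\<Prod>j=1..<i. degree_ratio n k d j)"
  using assms(1,2)
proof (induction i rule: dec_induct)
  case (step i)
  have pos: "real n - real d - real i > 0" "real k - real i > 0" using assms step by auto
  have "degree_ev n k d (Suc i) = degree_ratio n k d i * degree_ev n k d i"
  proof (cases "i < d")
    case True
    with pos show ?thesis
      using degree_ev_Suc[of i d k n] assms by (simp add: degree_ratio_def field_simps)
  next
    case False
    then show ?thesis by (cases "i = d") (auto simp: degree_ev_def degree_ratio_def)
  qed
  with step show ?case by (simp add: mult_ac)
qed simp

text \<open>The degree ratio is the Kneser ratio times \<open>y^2\<close>, where
  \<open>1 - y\<close> carries a factor \<open>k - d\<close>. The gap estimate then follows from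
  \<open>1 - y^2 <= 2 * (1 - y)\<close>.\<close>

lemma ratio_bounds:
  assumes "d < k" "2 * k < n" "j < k"
  shows "0 < kneser_ratio n k j" "kneser_ratio n k j < 1" "0 \<le> degree_ratio n k d j"
    and "j \<le> d \<Longrightarrow> degree_ratio n k d j \<le> kneser_ratio n k j"
    and "j \<le> d \<Longrightarrow> kneser_ratio n k j - degree_ratio n k d j
      \<le> 2 * (real k - real d) * (1 + kneser_ratio n k j) / (real n - real k - real j)"
proof -
  define m K D c where "m = real n - real k - real j" and "K = real k - real j" and "D = real d - real j"
    and "c = real k - real d"
  have pos: "m > 0" "K > 0" "c > 0" "K < m" using assms by (auto simp: m_def K_def c_def)
  have eqs: "real n - real d - real j = m + c" "D = K - c"
    by (auto simp: m_def D_def K_def c_def)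
  have u: "kneser_ratio n k j = K / m" and v: "degree_ratio n k d j = D\<^sup>2 * m / ((m + c)\<^sup>2 * K)"
    unfolding kneser_ratio_def degree_ratio_def eqs(1)[symmetric] by (simp_all add: m_def K_def D_def)
  show "0 < kneser_ratio n k j" "kneser_ratio n k j < 1" "0 \<le> degree_ratio n k d j"
    using pos by (auto simp: u v)
  define y where "y = D * m / ((m + c) * K)"
  have v': "degree_ratio n k d j = K / m * y\<^sup>2"
  proof -
    have "K / m * (D\<^sup>2 * m\<^sup>2 / (A * K\<^sup>2)) = D\<^sup>2 * m / (A * K)" if "A > 0" for A
      using that pos by (simp add: power2_eq_square)
    from this[of "(m + c)\<^sup>2"] show ?thesis
      using pos by (simp add: v y_def power_divide power_mult_distrib)
  qed
  have y1: "1 - y = c * (m + K) / ((m + c) * K)"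
  proof -
    have "1 - y = ((m + c) * K - D * m) / ((m + c) * K)"
      using pos by (simp add: y_def diff_divide_distrib)
    also have "(m + c) * K - D * m = c * (m + K)"
      by (simp add: eqs algebra_simps)
    finally show ?thesis .
  qed
  assume "j \<le> d"
  then have "y \<ge> 0" using pos by (simp add: y_def D_def)
  have "1 - y \<ge> 0" unfolding y1 using pos by simp
  then have "y\<^sup>2 \<le> 1" using \<open>y \<ge> 0\<close> by (simp add: power_le_one)
  then show "degree_ratio n k d j \<le> kneser_ratio n k j"
    unfolding u v' using pos by (simp add: field_simps)
  have "1 - y\<^sup>2 \<le> 2 * (1 - y)"
    using zero_le_power2[of "1 - y"] by (simp add: power2_eq_square algebra_simps)
  then have "K / m * (1 - y\<^sup>2) \<le> K / m * (2 * (1 - y))"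
    using pos by (intro mult_left_mono) auto
  also have "\<dots> = 2 * c * (m + K) / (m * (m + c))"
  proof -
    have "K / m * (2 * (c * B / (A * K))) = 2 * c * B / (m * A)" if "A > 0" for A B
      using that pos by (simp add: field_simps)
    from this[of "m + c" "m + K"] show ?thesis
      using pos by (simp add: y1)
  qed
  also have "\<dots> \<le> 2 * c * (m + K) / (m * m)"
    using pos by (intro divide_left_mono) auto
  also have "\<dots> = 2 * c * (1 + K / m) / m"
    using pos by (simp add: field_simps)
  finally show "kneser_ratio n k j - degree_ratio n k d j
      \<le> 2 * (real k - real d) * (1 + kneser_ratio n k j) / (real n - real k - real j)"
    unfolding u v' m_def[symmetric] c_def[symmetric] by (simp add: algebra_simps)
qed

section \<open>Polynomial inequalities for the product estimate\<close>

lemma cubic_bound: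
  fixes K D M :: real
  assumes "2 \<le> D" "D + 1 \<le> K" "K + 2 * D - 3 \<le> M" "4 * D\<^sup>2 - 10 * D \<le> 3 * K\<^sup>2 - 9 * K"
  shows "K * ((K - 1) * (K - 2)) \<le> (K - D) * ((M - 1) * (M - 2))"
proof -
  \<comment> \<open>At the least admissible value \<open>M = K + 2 * D - 3\<close> the difference of
    the two sides factors as \<open>D - 2\<close> times the quadratic of the last
    hypothesis.\<close>
  have "0 \<le> (D - 2) * (3 * K\<^sup>2 - 9 * K - (4 * D\<^sup>2 - 10 * D))"
    using assms by (intro mult_nonneg_nonneg) auto
  also have "\<dots> = (K - D) * ((K + 2 * D - 4) * (K + 2 * D - 5)) - K * ((K - 1) * (K - 2))"
    by (simp add: power2_eq_square algebra_simps)
  finally have "K * ((K - 1) * (K - 2)) \<le> (K - D) * ((K + 2 * D - 4) * (K + 2 * D - 5))"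
    by simp
  also have "\<dots> \<le> (K - D) * ((M - 1) * (M - 2))"
    using assms by (intro mult_left_mono mult_mono) auto
  finally show ?thesis .
qed

lemma quadratic_dichotomy:
  fixes K D :: real
  assumes "2 \<le> D" "D + 1 \<le> K" "4 * D - 2 \<le> 3 * K \<or> D \<le> 6"
  shows "4 * D\<^sup>2 - 10 * D \<le> 3 * K\<^sup>2 - 9 * K"
proof (cases "D \<le> 6")
  case True
  \<comment> \<open>The first product is the value of the difference at \<open>K = D + 1\<close>,
    the second its growth from there.\<close>
  have "0 \<le> (D - 1) * (6 - D) + (K - (D + 1)) * (3 * (K + D + 1) - 9)"
    using assms True by (intro add_nonneg_nonneg mult_nonneg_nonneg) auto
  then show ?thesis by (simp add: power2_eq_square algebra_simps)
next
  case False
  with assms have K: "4 * D - 2 \<le> 3 * K" by simp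
  have "0 \<le> (3 * K - (4 * D - 2)) * (3 * K + 4 * D - 2 - 9)"
    using K False by (intro mult_nonneg_nonneg) auto
  moreover have "0 \<le> (D - 5) * (4 * D - 2)"
    using False by (intro mult_nonneg_nonneg) auto
  ultimately show ?thesis
    using False by (simp add: power2_eq_square algebra_simps)
qed

text \<open>Covers the range left open by \<open>quadratic_dichotomy\<close>; it is the base case
  \<open>i = 3\<close> of the induction in \<open>prod_gap\<close>, cleared of denominators.\<close>

lemma quadratic_bound:
  fixes K D M :: real
  assumes "7 \<le> D" "D + 1 \<le> K" "3 * K \<le> 4 * D - 3" "K + 2 * D - 3 \<le> M" "u \<le> 2/5" "v \<le> 2/5"
  shows "2 * D * ((K - 2) * (1 + u) + (K - 1) * (1 + v)) \<le> (M - 1) * (M - 2) - (K - 1) * (K - 2)"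
proof -
  have "2 * D * ((K - 2) * (1 + u) + (K - 1) * (1 + v)) \<le> 2 * D * ((K - 2) * (7/5) + (K - 1) * (7/5))"
    using assms by (intro mult_left_mono add_mono) auto
  also have "\<dots> \<le> (K + 2 * D - 4) * (K + 2 * D - 5) - (K - 1) * (K - 2)"
  proof -
    \<comment> \<open>The factor \<open>8 * D + 30\<close> makes this product absorb all terms
      containing \<open>K\<close>; the remaining quadratic in \<open>D\<close> exceeds the next
      product by a constant.\<close>
    have "0 \<le> (8 * D + 30) * (4 * D - 3 - 3 * K)"
      using assms by (intro mult_nonneg_nonneg) auto
    moreover have "0 \<le> (D - 7) * (28 * D - 44)"
      using assms by (intro mult_nonneg_nonneg) auto
    ultimately have "3 * (14 * (D * (2 * K - 3))) \<le> 15 * ((K + 2 * D - 4) * (K + 2 * D - 5) - (K - 1) * (K - 2))"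
      by (simp add: algebra_simps)
    moreover have "5 * (2 * D * ((K - 2) * (7/5) + (K - 1) * (7/5))) = 14 * (D * (2 * K - 3))"
      by (simp add: field_simps)
    moreover have "a \<le> b" if "3 * z \<le> 15 * b" "5 * a = z" for a b z :: real
      using that by linarith
    ultimately show ?thesis by blast
  qed
  also have "\<dots> \<le> (M - 1) * (M - 2) - (K - 1) * (K - 2)"
    using assms by (intro diff_right_mono mult_mono) auto
  finally show ?thesis .
qed

section \<open>Products of eigenvalue ratios\<close>

lemma degree_prod_eq_0:
  assumes "1 \<le> d" "d < i"
  shows "(\<Prod>j=1..<i. degree_ratio n k d j) = 0"
  using assms by (intro prod_zero bexI[of _ d]) (auto simp: degree_ratio_def)

text \<open>The factorwise comparison is available only up to \<open>d\<close>; for larger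
  \<open>i\<close> the degree product contains the zero factor at \<open>j = d\<close>.\<close>

lemma degree_prod_le:
  assumes "1 \<le> d" "d < k" "2 * k < n" "i \<le> k"
  shows "0 \<le> (\<Prod>j=1..<i. degree_ratio n k d j)"
    "(\<Prod>j=1..<i. degree_ratio n k d j) \<le> (\<Prod>j=1..<i. kneser_ratio n k j)"
    "0 < (\<Prod>j=1..<i. kneser_ratio n k j)"
proof -
  show "0 \<le> (\<Prod>j=1..<i. degree_ratio n k d j)"
    using ratio_bounds[OF assms(2,3)] assms by (intro prod_nonneg) auto
  show pos: "0 < (\<Prod>j=1..<i. kneser_ratio n k j)"
    using ratio_bounds[OF assms(2,3)] assms by (intro prod_pos) auto
  show "(\<Prod>j=1..<i. degree_ratio n k d j) \<le> (\<Prod>j=1..<i. kneser_ratio n k j)"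
  proof (cases "i \<le> d")
    case True
    then show ?thesis
      using ratio_bounds[OF assms(2,3)] assms by (intro prod_mono) auto
  next
    case False
    then have zero: "(\<Prod>j=1..<i. degree_ratio n k d j) = 0"
      using assms(1) by (intro degree_prod_eq_0) auto
    show ?thesis unfolding zero using pos by simp
  qed
qed

lemma kneser_prod_antimono:
  assumes "d < k" "2 * k < n" "1 \<le> i" "i \<le> j" "j \<le> k"
  shows "(\<Prod>l=1..<j. kneser_ratio n k l) \<le> (\<Prod>l=1..<i. kneser_ratio n k l)"
  using assms(4,5)
proof (induction j rule: dec_induct)
  case (step j)
  have "0 \<le> (\<Prod>l=1..<j. kneser_ratio n k l)"
    using ratio_bounds[OF assms(1,2)] step by (intro prod_nonneg) (auto intro: less_imp_le)
  then have "(\<Prod>l=1..<j. kneser_ratio n k l) * kneser_ratio n k j \<le> (\<Prod>l=1..<j. kneser_ratio n k l) * 1"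
    using ratio_bounds[OF assms(1,2), of j] step by (intro mult_left_mono) auto
  with step assms show ?case by simp
qed simp

lemma prod_upto_3:
  fixes f :: "nat \<Rightarrow> real"
  shows "(\<Prod>j=1..<3. f j) = f 1 * f 2"
proof -
  have "{1..<3::nat} = {1,2}" by auto
  then show ?thesis by simp
qed

text \<open>Unless \<open>k\<close> is close to \<open>d\<close>, the subtracted product can be dropped. Otherwise the gap between the two
  products is proportional to \<open>k - d\<close>, and the claim in the form \<open>d (P - Q) \<le> (k - d) (1 - P)\<close> goes through by
  induction on \<open>i\<close>.\<close>

lemma prod_gap:
  assumes d: "2 \<le> d" "d < k" and n: "2 * k + 2 * d - 3 \<le> n" and i: "3 \<le> i" "i \<le> k"
  shows "real k * (\<Prod>j=1..<i. kneser_ratio n k j) - real d * (\<Prod>j=1..<i. degree_ratio n k d j)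
    \<le> real k - real d"
proof -
  define P where "P i = (\<Prod>j=1..<i. kneser_ratio n k j)" for i
  define Q where "Q i = (\<Prod>j=1..<i. degree_ratio n k d j)" for i
  define M where "M = real n - real k"
  have n2: "2 * k < n" using d n by simp
  note rb = ratio_bounds[OF d(2) n2]
  have M: "real k + 2 * real d - 3 \<le> M" and M': "real k < M" using n d by (auto simp: M_def)
  have P3: "P 3 = (real k - 1) * (real k - 2) / ((M - 1) * (M - 2))"
    unfolding P_def prod_upto_3 by (simp add: kneser_ratio_def M_def)
  have mono: "P i \<le> P 3" if "3 \<le> i" "i \<le> k" for i
    using kneser_prod_antimono[OF d(2) n2, of 3 i] that by (simp add: P_def)
  show ?thesis
  proof (cases "4 * real d - 2 \<le> 3 * real k \<or> d \<le> 6")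
    case True
    then have "4 * (real d)\<^sup>2 - 10 * real d \<le> 3 * (real k)\<^sup>2 - 9 * real k"
      using d by (intro quadratic_dichotomy) auto
    then have "real k * ((real k - 1) * (real k - 2)) \<le> (real k - real d) * ((M - 1) * (M - 2))"
      using d M by (intro cubic_bound) auto
    then have "real k * P 3 \<le> real k - real d"
      using M' d by (simp add: P3 pos_divide_le_eq)
    moreover have "real k * P i \<le> real k * P 3"
      using mono[OF i] by (intro mult_left_mono) auto
    moreover have "0 \<le> real d * Q i"
      using degree_prod_le(1)[of d k n i] d n2 i by (simp add: Q_def)
    ultimately show ?thesis by (simp add: P_def Q_def)
  next
    case False
    \<comment> \<open>Returning to integers gains the unit that turns the strict inequality into
      \<open>3 * k + 3 <= 4 * d\<close>, as \<open>quadratic_bound\<close> demands.\<close>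
    then have "real (3 * k + 2) < real (4 * d)" and d7: "7 \<le> d" by auto
    then have "3 * k + 3 \<le> 4 * d" by (simp only: of_nat_less_iff)
    then have k3: "3 * real k \<le> 4 * real d - 3" by linarith
    define c where "c = real k - real d"
    have c: "c > 0" using d by (simp add: c_def)
    define u where "u j = kneser_ratio n k j" for j
    define v where "v j = degree_ratio n k d j" for j
    \<comment> \<open>Here \<open>2 * M >= 2 * k + 4 * d - 6 >= 5 * k - 3\<close>, just enough at
      \<open>j = 1\<close>; the later ratios are smaller.\<close>
    have u25: "u j \<le> 2/5" if "1 \<le> j" "j < k" for j
      using that M M' k3 by (simp add: u_def kneser_ratio_def M_def pos_divide_le_eq)
    \<comment> \<open>The factor \<open>Q i\<close> extends the gap bound beyond \<open>d\<close>,
      where \<open>ratio_bounds\<close> is silent but \<open>Q i\<close> is zero.\<close>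
    have gap: "Q i * (u i - v i) \<le> Q i * (2 * c * (1 + u i) / (M - real i))" if "i < k" for i
    proof (cases "i \<le> d")
      case True
      then show ?thesis
        using rb(5)[of i] that degree_prod_le(1)[of d k n i] d n2
        by (intro mult_left_mono) (auto simp: u_def v_def c_def M_def Q_def)
    next
      case False
      then have "Q i = 0" unfolding Q_def using d by (intro degree_prod_eq_0) auto
      then show ?thesis by simp
    qed
    have "real d * (P i - Q i) \<le> c * (1 - P i)"
      using i
    proof (induction i rule: dec_induct)
      case base
      have b1: "u 1 - v 1 \<le> 2 * c * (1 + u 1) / (M - 1)" and b2: "u 2 - v 2 \<le> 2 * c * (1 + u 2) / (M - 2)"
        using rb(5)[of 1] rb(5)[of 2] d by (auto simp: u_def v_def c_def M_def)
      have u12: "u 1 = (real k - 1) / (M - 1)" "u 2 = (real k - 2) / (M - 2)"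
        by (auto simp: u_def kneser_ratio_def M_def)
      have "P 3 - Q 3 = u 2 * (u 1 - v 1) + v 1 * (u 2 - v 2)"
        unfolding P_def Q_def prod_upto_3 u_def v_def by (simp add: algebra_simps)
      also have "\<dots> \<le> u 2 * (2 * c * (1 + u 1) / (M - 1)) + u 1 * (2 * c * (1 + u 2) / (M - 2))"
      proof (rule add_mono)
        show "u 2 * (u 1 - v 1) \<le> u 2 * (2 * c * (1 + u 1) / (M - 1))"
          using b1 rb(1)[of 2] d by (intro mult_left_mono) (auto simp: u_def)
        show "v 1 * (u 2 - v 2) \<le> u 1 * (2 * c * (1 + u 2) / (M - 2))"
          using b2 rb(3)[of 1] rb(4)[of 1] rb(4)[of 2] d
          by (intro mult_mono) (auto simp: u_def v_def)
      qed
      also have "\<dots> = c * (2 * ((real k - 2) * (1 + u 1) + (real k - 1) * (1 + u 2))) / ((M - 1) * (M - 2))"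
      proof -
        have "b / m2 * (2 * c * x / m1) + a / m1 * (2 * c * y / m2) = c * (2 * (b * x + a * y)) / (m1 * m2)"
          if "m1 > 0" "m2 > 0" for a b x y m1 m2 :: real
          using that by (simp add: field_simps)
        from this[of "M - 1" "M - 2" "real k - 2" "1 + u 1" "real k - 1" "1 + u 2"] show ?thesis
          using M' d by (simp add: u12(1)[symmetric] u12(2)[symmetric])
      qed
      finally have "real d * (P 3 - Q 3)
          \<le> real d * (c * (2 * ((real k - 2) * (1 + u 1) + (real k - 1) * (1 + u 2))) / ((M - 1) * (M - 2)))"
        by (intro mult_left_mono) auto
      also have "\<dots> = c * (2 * real d * ((real k - 2) * (1 + u 1) + (real k - 1) * (1 + u 2))) / ((M - 1) * (M - 2))"
        by (simp only: mult_ac times_divide_eq_right)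
      also have "\<dots> \<le> c * ((M - 1) * (M - 2) - (real k - 1) * (real k - 2)) / ((M - 1) * (M - 2))"
        using quadratic_bound[of "real d" "real k" M "u 1" "u 2"] d d7 k3 M M' u25[of 1] u25[of 2] c
        by (intro divide_right_mono mult_left_mono) auto
      also have "\<dots> = c * (1 - P 3)"
      proof -
        have "c * (w - z) / w = c * (1 - z / w)" if "w > 0" for w z
          using that by (simp add: field_simps)
        from this[of "(M - 1) * (M - 2)"] show ?thesis
          using M' d by (simp only: P3) simp
      qed
      finally show ?case .
    next
      case (step i)
      have ik: "3 \<le> i" "i < k" using step by auto
      have Suc_eq: "P (Suc i) = P i * u i" "Q (Suc i) = Q i * v i"
        using ik by (auto simp: P_def Q_def u_def v_def)
      have u: "0 < u i" "u i \<le> 2/5" and Mi: "0 < M - real i" using rb(1)[of i] u25[of i] ik M' by (auto simp: u_def)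
      have PQ: "0 \<le> Q i" "Q i \<le> P i" "0 < P i"
        using degree_prod_le[of d k n i] d n2 ik by (auto simp: P_def Q_def)
      have "P 3 \<le> 2/5 * (2/5)"
        unfolding P_def prod_upto_3 u_def[symmetric] using u25[of 1] u25[of 2] rb(1)[of 2] d
        by (intro mult_mono) (auto simp: u_def)
      then have P: "P i \<le> 2/5 * (2/5)" using mono[of i] ik by simp
      have "P i * (1 + u i) \<le> (2/5 * (2/5)) * (1 + 2/5)"
        using P u by (intro mult_mono) auto
      then have "2 * real d * (P i * (1 + u i)) \<le> 2 * real d * ((2/5 * (2/5)) * (1 + 2/5))"
        by (intro mult_left_mono) auto
      \<comment> \<open>The left side is \<open>56/125 * d\<close>, while
        \<open>M - k >= 2 * d - 3\<close>.\<close>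
      also have "\<dots> \<le> M - real k" using M d by simp
      also have "\<dots> = (1 - u i) * (M - real i)"
        using Mi by (simp add: u_def kneser_ratio_def M_def field_simps)
      finally have key: "2 * real d * (P i * (1 + u i)) / (M - real i) \<le> 1 - u i"
        using Mi by (simp add: pos_divide_le_eq)
      have "real d * (P (Suc i) - Q (Suc i)) = u i * (real d * (P i - Q i)) + real d * (Q i * (u i - v i))"
        by (simp add: Suc_eq algebra_simps)
      also have "\<dots> \<le> u i * (c * (1 - P i)) + real d * (P i * (2 * c * (1 + u i) / (M - real i)))"
      proof (rule add_mono)
        show "u i * (real d * (P i - Q i)) \<le> u i * (c * (1 - P i))"
          using step u by (intro mult_left_mono) auto
        have "Q i * (2 * c * (1 + u i) / (M - real i)) \<le> P i * (2 * c * (1 + u i) / (M - real i))"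
          using PQ c u Mi by (intro mult_right_mono) auto
        with gap[OF ik(2)] show "real d * (Q i * (u i - v i)) \<le> real d * (P i * (2 * c * (1 + u i) / (M - real i)))"
          by (intro mult_left_mono) auto
      qed
      also have "real d * (P i * (2 * c * (1 + u i) / (M - real i))) = c * (2 * real d * (P i * (1 + u i)) / (M - real i))"
        by simp
      also have "u i * (c * (1 - P i)) + c * (2 * real d * (P i * (1 + u i)) / (M - real i))
          \<le> u i * (c * (1 - P i)) + c * (1 - u i)"
        using mult_left_mono[OF key, of c] c by simp
      \<comment> \<open>The two terms combine because
        \<open>u * (1 - P) + (1 - u) = 1 - u * P\<close>.\<close>
      also have "\<dots> = c * (1 - P (Suc i))"
        by (simp add: Suc_eq algebra_simps)
      finally show ?case .
    qed
    then show ?thesis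
      by (simp add: P_def Q_def c_def algebra_simps)
  qed
qed

subsection \<open>Combining the two forms\<close>

lemma degree_ev_1:
  assumes "1 \<le> d" "d < k" "2 * k \<le> n"
  shows "degree_ev n k d 1 = real d ^ 2 * (real n - real k) / ((real n - real d)\<^sup>2 * real k) * degree_ev n k d 0"
proof -
  have "real n - real d > 0" using assms by simp
  then show ?thesis
    using degree_ev_Suc[of 0 d k n] assms by (simp add: field_simps)
qed

lemma kneser_ev_1:
  assumes "1 \<le> k" "2 * k \<le> n"
  shows "kneser_ev n k 0 = (real n - real k) / real k * kneser_ev n k 1"
  using kneser_ev_Suc[of 0 k n] assms by (simp add: field_simps)

lemma intersecting_degree_bound:
  assumes V: "finite V" and dk: "2 \<le> d" "d < k" and n: "2 * k + 2 * d - 3 \<le> card V"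
    and F: "F \<subseteq> nsets V k" "intersecting F"
  shows "\<exists>S\<in>nsets V d. set_degree S F \<le> (card V - d - 1) choose (k - d - 1)"
proof (rule ccontr)
  assume "\<not> ?thesis"
  then have deg: "set_degree S F > (card V - d - 1) choose (k - d - 1)" if "S \<in> nsets V d" for S
    using that by force
  define n where "n = card V"
  define K D M where "K = real k" and "D = real d" and "M = real n"
  have n2: "2 * k < n" using dk n by (simp add: n_def)
  have real: "2 \<le> D" "D < K" "2 * K < M"
    using dk n2 by (auto simp: D_def K_def M_def)
  define c where "c = (K - D) / (M - D)"
  define N where "N = real (n choose k)"
  define p where "p = real (card F) / N"
  have N0: "N > 0" using n2 by (simp add: N_def)
  define P where "P i = (\<Prod>j=1..<i. kneser_ratio n k j)" for i
  define Q where "Q i = (\<Prod>j=1..<i. degree_ratio n k d j)" for i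
  have c0: "c > 0" using real by (simp add: c_def)
  \<comment> \<open>Absorption: \<open>c\<close> is the proportion of the \<open>k\<close>-sets
    above a \<open>d\<close>-set that contain one given further point.\<close>
  have "c * real ((n - d) choose (k - d)) = real ((n - d - 1) choose (k - d - 1))"
  proof -
    obtain b where b: "k - d = Suc b" using dk by (metis Suc_diff_Suc)
    then have "real (Suc b) * real ((n - d) choose Suc b) = real (n - d) * real ((n - d - 1) choose b)"
      using binomial_absorption[of b "n - d"] by (metis of_nat_mult)
    moreover have "K - D = real (Suc b)" "M - D = real (n - d)" "real (n - d) > 0"
      using b dk n2 by (auto simp: K_def D_def M_def)
    moreover have "s / m * x = y" if "s * x = m * y" "m > 0" for s m x y :: real
      using that by (simp add: field_simps)
    ultimately show ?thesis
      unfolding c_def b diff_Suc_1 by simp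
  qed
  then have deg': "real (set_degree S F) > c * real ((card V - d) choose (k - d))" if "S \<in> nsets V d" for S
    using deg[OF that] by (simp add: n_def)
  have kV: "2 * k \<le> card V" using n2 by (simp add: n_def)
  obtain X where X: "\<And>i. i \<le> k \<Longrightarrow> X i \<ge> 0" "X 0 = N * p\<^sup>2" "(\<Sum>i\<le>k. X i) = N * p"
    "(\<Sum>i\<le>k. (-1) ^ i * kneser_ev n k i * X i) = 0"
    and form: "p > c" "degree_ev n k d 0 * N * (p - c)\<^sup>2 + (\<Sum>i=1..d. (-1) ^ i * degree_ev n k d i * X i) > 0"
  proof (rule intersecting_spectrum[OF V kV F])
    show "N = real (card V choose k)" by (simp add: N_def n_def)
    show "p = real (card F) / N" by (simp add: p_def)
  next
    fix X
    assume X: "\<And>i. i \<le> k \<Longrightarrow> X i \<ge> 0" "X 0 = N * p\<^sup>2" "(\<Sum>i\<le>k. X i) = N * p"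
      "(\<Sum>i\<le>k. (-1) ^ i * kneser_ev (card V) k i * X i) = 0"
      and form: "\<And>d c. d \<le> k \<Longrightarrow>
        (\<And>S. S \<in> nsets V d \<Longrightarrow> real (set_degree S F) > c * real ((card V - d) choose (k - d))) \<Longrightarrow>
        p > c \<and> degree_ev (card V) k d 0 * N * (p - c)\<^sup>2 + (\<Sum>i=1..d. (-1) ^ i * degree_ev (card V) k d i * X i) > 0"
    show thesis
      using that[of X] X form[of d c, OF less_imp_le[OF dk(2)] deg'] unfolding n_def by blast
  qed
  have PQ: "0 \<le> Q i" "Q i \<le> P i" "0 < P i" if "i \<le> k" for i
    using degree_prod_le[of d k n i] dk n2 that by (auto simp: P_def Q_def)
  have E1: "kneser_ev n k 1 > 0" using n2 by (simp add: kneser_ev_def)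
  have D0: "degree_ev n k d 0 > 0" using n2 dk by (simp add: degree_ev_def)
  \<comment> \<open>The level-1 eigenvalue of the degree form divided by the level-0 one, sign
    aside.\<close>
  define r where "r = D\<^sup>2 * (M - K) / ((M - D)\<^sup>2 * K)"
  have r0: "r > 0" using real by (simp add: r_def)
  have sumX: "(\<Sum>i=1..k. X i) = N * p - N * p\<^sup>2"
    using X(2,3) by (simp add: sum_atMost_split)
  \<comment> \<open>Both forms without level 0, normalized so that level 1 has coefficient
    -1.\<close>
  define \<alpha> where "\<alpha> = (\<Sum>i=1..k. (-1) ^ i * P i * X i)"
  define \<beta> where "\<beta> = (\<Sum>i=1..k. (-1) ^ i * Q i * X i)"
  have kneser: "\<alpha> = - ((M - K) / K * (N * p\<^sup>2))"
  proof -
    have "0 = kneser_ev n k 0 * X 0 + (\<Sum>i=1..k. (-1) ^ i * kneser_ev n k i * X i)"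
      using X(4) by (simp add: sum_atMost_split)
    also have "(\<Sum>i=1..k. (-1) ^ i * kneser_ev n k i * X i) = kneser_ev n k 1 * \<alpha>"
      unfolding \<alpha>_def sum_distrib_left
    proof (rule sum.cong[OF refl])
      fix i assume "i \<in> {1..k}"
      then have eq: "kneser_ev n k i = kneser_ev n k 1 * P i"
        unfolding P_def using n2 by (intro kneser_ev_eq) auto
      show "(-1) ^ i * kneser_ev n k i * X i = kneser_ev n k 1 * ((-1) ^ i * P i * X i)"
        unfolding eq by (simp only: mult_ac)
    qed
    also have "kneser_ev n k 0 = (M - K) / K * kneser_ev n k 1"
      using kneser_ev_1[of k n] dk n2 by (simp add: M_def K_def)
    finally have "0 = kneser_ev n k 1 * ((M - K) / K * X 0 + \<alpha>)"
      by (simp add: algebra_simps)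
    with E1 have "(M - K) / K * X 0 + \<alpha> = 0" by simp
    then show ?thesis by (simp add: X(2))
  qed
  have degree: "0 < N * (p - c)\<^sup>2 + r * \<beta>"
  proof -
    have "(\<Sum>i=1..d. (-1) ^ i * degree_ev n k d i * X i) = (\<Sum>i=1..k. (-1) ^ i * degree_ev n k d i * X i)"
      using dk by (intro sum.mono_neutral_left) (auto simp: degree_ev_def)
    also have "\<dots> = degree_ev n k d 1 * \<beta>"
      unfolding \<beta>_def sum_distrib_left
    proof (rule sum.cong[OF refl])
      fix i assume "i \<in> {1..k}"
      then have eq: "degree_ev n k d i = degree_ev n k d 1 * Q i"
        unfolding Q_def using dk n2 by (intro degree_ev_eq) auto
      show "(-1) ^ i * degree_ev n k d i * X i = degree_ev n k d 1 * ((-1) ^ i * Q i * X i)"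
        unfolding eq by (simp only: mult_ac)
    qed
    also have "degree_ev n k d 1 = r * degree_ev n k d 0"
      using degree_ev_1[of d k n] dk n2 by (simp add: r_def D_def K_def M_def)
    finally have "0 < degree_ev n k d 0 * (N * (p - c)\<^sup>2 + r * \<beta>)"
      using form(2) by (simp add: algebra_simps)
    with D0 show ?thesis by (simp add: zero_less_mult_iff)
  qed
  have p0: "p > 0" using form(1) c0 by simp
  \<comment> \<open>Hoffman's ratio bound: the normalized coefficients in \<open>\<alpha>\<close>
    are at least -1.\<close>
  have ekr: "p * M \<le> K"
  proof -
    have "- (\<Sum>i=1..k. X i) \<le> \<alpha>"
      unfolding \<alpha>_def sum_negf[symmetric]
    proof (rule sum_mono)
      fix i assume i: "i \<in> {1..k}"
      have "P i \<le> 1"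
        using kneser_prod_antimono[of d k n 1 i] dk n2 i by (simp add: P_def)
      then have "P i * X i \<le> 1 * X i" "0 \<le> P i * X i"
        using X(1)[of i] PQ[of i] i mult_right_mono[of "P i" 1 "X i"] by auto
      then show "- X i \<le> (-1) ^ i * P i * X i"
        by (cases "even i") auto
    qed
    then have "(M - K) / K * (N * p\<^sup>2) \<le> N * p - N * p\<^sup>2"
      unfolding kneser sumX by simp
    then have "(M - K) * (N * p\<^sup>2) \<le> (N * p - N * p\<^sup>2) * K"
      using real by (simp add: pos_divide_le_eq)
    then have "(N * p) * (p * M) \<le> (N * p) * K"
      by (simp add: power2_eq_square algebra_simps)
    then show ?thesis using N0 p0 by simp
  qed
  \<comment> \<open>The multiplier \<open>K / D\<close> is the one for which both sides agree on level 1.\<close>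
  have "D * \<beta> \<le> K * \<alpha> + (K - D) * (\<Sum>i=1..k. X i)"
  proof -
    have "(\<Sum>i=1..k. D * ((-1) ^ i * Q i * X i)) \<le> (\<Sum>i=1..k. K * ((-1) ^ i * P i * X i) + (K - D) * X i)"
    proof (rule sum_mono)
      fix i assume i: "i \<in> {1..k}"
      note PQi = PQ[of i]
      \<comment> \<open>Even levels hold since the degree products are the smaller ones, and level 1
        is an equality. Only the odd levels from 3 on need \<open>prod_gap\<close>, and with it the
        lower bound on \<open>n\<close>.\<close>
      have "(-1) ^ i * (D * Q i - K * P i) \<le> K - D"
      proof (cases "even i")
        case True
        have "D * Q i \<le> K * P i"
          using PQi i real by (intro mult_mono) auto
        with True real show ?thesis by simp
      next
        case False
        have "K * P i - D * Q i \<le> K - D"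
        proof (cases "i = 1")
          case False
          with \<open>odd i\<close> i have "3 \<le> i" by (auto elim!: oddE)
          then show ?thesis
            using prod_gap[of d k n i] dk n i by (simp add: P_def Q_def K_def D_def n_def)
        qed (simp add: P_def Q_def)
        with False show ?thesis by simp
      qed
      then have "(-1) ^ i * (D * Q i - K * P i) * X i \<le> (K - D) * X i"
        using X(1)[of i] i by (intro mult_right_mono) auto
      then show "D * ((-1) ^ i * Q i * X i) \<le> K * ((-1) ^ i * P i * X i) + (K - D) * X i"
        by (simp add: algebra_simps)
    qed
    then show ?thesis
      by (simp add: \<alpha>_def \<beta>_def sum.distrib sum_distrib_left)
  qed
  \<comment> \<open>The terms in \<open>p^2\<close> add up to \<open>-(M - D) * N * p^2\<close>, and
    \<open>K - D = c * (M - D)\<close>, so that a factor \<open>p - c\<close> splits off.\<close>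
  also have "K * \<alpha> + (K - D) * (\<Sum>i=1..k. X i) = - (N * (M - D) * (p * (p - c)))"
    unfolding kneser sumX c_def using real by (simp add: power2_eq_square field_simps)
  finally have "r * (D * \<beta>) \<le> r * (- (N * (M - D) * (p * (p - c))))"
    using r0 by (intro mult_left_mono) auto
  moreover have "0 < D * (N * (p - c)\<^sup>2 + r * \<beta>)"
    using degree real by simp
  ultimately have "0 < D * (N * (p - c)\<^sup>2) - r * (N * (M - D) * (p * (p - c)))"
    by (simp add: algebra_simps)
  also have "\<dots> = D * N * (p - c) * ((p - c) - r * (M - D) / D * p)"
    using real by (simp add: power2_eq_square field_simps)
  also have "r * (M - D) / D = D * (M - K) / ((M - D) * K)"
    using real by (simp add: r_def power2_eq_square)
  \<comment> \<open>The bracket vanishes exactly at the density \<open>K / M\<close> of a full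
    star.\<close>
  also have "(p - c) - D * (M - K) / ((M - D) * K) * p = c * (p * M / K - 1)"
  proof -
    have "1 - D * (M - K) / ((M - D) * K) = c * (M / K)"
      using real by (simp add: c_def field_simps)
    then have "(1 - D * (M - K) / ((M - D) * K)) * p = c * (M / K) * p" by simp
    then show ?thesis by (simp add: algebra_simps)
  qed
  finally have "0 < D * N * (p - c) * (c * (p * M / K - 1))" .
  moreover have "D * N * (p - c) \<ge> 0" using real N0 form(1) by simp
  moreover have "p * M / K - 1 \<le> 0" using ekr real by (simp add: pos_divide_le_eq)
  then have "c * (p * M / K - 1) \<le> 0" using c0 by (simp add: mult_le_0_iff)
  ultimately show False
    using mult_nonneg_nonpos[of "D * N * (p - c)" "c * (p * M / K - 1)"] by linarith
qed

theorem theorem1p1: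
  fixes n k d :: nat and F :: "nat set set"
  assumes "d \<ge> 2" and "k > d" and "n \<ge> 2 * k + 2 * d - 3"
    and "F \<subseteq> nsets {1..n} k" and "intersecting F"
  shows "min_degree {1..n} d F \<le> (n - d - 1) choose (k - d - 1)"
proof -
  obtain S where "S \<in> nsets {1..n} d" "set_degree S F \<le> (n - d - 1) choose (k - d - 1)"
    using intersecting_degree_bound[of "{1..n}" d k F] assms by auto
  moreover from this have "min_degree {1..n} d F \<le> set_degree S F"
    unfolding min_degree_def by (intro Min_le) auto
  ultimately show ?thesis by simp
qed

end
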